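(* Consider sparse domain sets $\mathcal{D}=\{X\in\mathcal{S}^n:\ X=\operatorname{Diag}(\operatorname{diag}(X)),\ \operatorname{rank}(X)\le k,\ f(\operatorname{diag}(X))\le0\}$ with strengthened rank $\tilde k\le k$. Then: (i) there exists an instance of LSOP-R with such a domain set and with sign-invariant $f$ whose feasible set contains an extreme point of rank $\tilde k+\tilde m$; and (ii) there exists an instance of LSOP-R-I with such a domain set in which the feasible set of one of the inner minimization problems contains an extreme point of rank $\tilde k+\tilde m$. (In each part, $\tilde k$ and $\tilde m$ are those of the instance in question.)
   Context: $k\le n$ are positive integers; $[m]=\{1,\dots,m\}$; $\mathcal{S}^n$ is the space of $n\times n$ real symmetric matrices; $\operatorname{diag}(X)\in\mathbb{R}^n$ is the vector of diagonal entries of $X$, and $\operatorname{Diag}(x)$ is the diagonal matrix with diagonal $x$; $\langle\cdot,\cdot\rangle$ is the Frobenius inner product; $\operatorname{conv}$ denotes convex hull. The function $f:\mathbb{R}^n\to\mathbb{R}$ is continuous, convex and symmetric (permutation-invariant); it is sign-invariant if $f(\lambda)=f(|\lambda|)$ for all $\lambda$, with entrywise absolute value. Data: $A_0,A_1,\dots,A_m\in\mathcal{S}^n$, $-\infty\le b_i^l\le b_i^u\le+\infty$, and $\tilde m$ is the dimension of the linear span of $\{A_i\}_{i\in[m]}$. Strengthened rank: $\tilde k$ with $1\le\tilde k\le k$ is the smallest integer such that $\operatorname{conv}(\mathcal{D})=\operatorname{conv}(\{X\in\mathcal{S}^n:\ X \text{ diagonal},\ \operatorname{rank}(X)\le\tilde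 k,\ f(\operatorname{diag}(X))\le0\})$. LSOP-R: $\min_{X\in\operatorname{conv}(\mathcal{D})}\{\langle A_0,X\rangle:\ b_i^l\le\langle A_i,X\rangle\le b_i^u,\ \forall i\in[m]\}$. LSOP-R-I: $\min_{s\in[\tilde k+1]}\min_{X\in\hat{\mathcal{Y}}^s}\{\langle A_0,X\rangle:\ b_i^l\le\langle A_i,X\rangle\le b_i^u,\ \forall i\in[m]\}$, where for $s\in[\tilde k+1]$ $$\hat{\mathcal{Y}}^s:=\{X\in\mathcal{S}^n:\ X=\operatorname{Diag}(\operatorname{diag}(X)),\ \exists x\in\mathbb{R}^n,\ f(x)\le0,\ x_1\ge\cdots\ge x_n,\ x_j=0\ \text{for } s\le j\le s+n-\tilde k-1,\ x\succeq\operatorname{diag}(X)\}.$$ Majorization: $x\succeq y$ means that for every $\ell\in[n]$ the sum of the $\ell$ largest entries of $x$ is at least the sum of the $\ell$ largest entries of $y$, and $\sum_i x_i=\sum_i y_i$. *)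

theory Defs
  imports "HOL-Analysis.Analysis" "HOL-Library.Function_Algebras"
begin

text \<open>
  The dimension of an instance is existentially quantified in the theorem, so it has to be a
  number rather than a type.  A vector of length \<open>n\<close> is a function on \<^typ>\<open>nat\<close> that vanishes outside
  \<open>{1..n}\<close>, an \<open>n \<times> n\<close> matrix a binary function that vanishes outside \<open>{1..n} \<times> {1..n}\<close>.  With the
  pointwise vector space structure on functions, the convex hulls, extreme points, spans and
  dimensions below are those of HOL-Analysis.
\<close>

instantiation "fun" :: (type, real_vector) real_vector
begin

definition scaleR_fun :: "real \<Rightarrow> ('a \<Rightarrow> 'b) \<Rightarrow> 'a \<Rightarrow> 'b" where
  "scaleR_fun r g = (\<lambda>x. r *\<^sub>R g x)"

instance
  by standard (simp_all add: scaleR_fun_def fun_eq_iff scaleR_add_right scaleR_add_left)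

end

lemma scaleR_fun_apply [simp]: "(r *\<^sub>R g) x = r *\<^sub>R g x"
  by (simp add: scaleR_fun_def)

definition vectors :: "nat \<Rightarrow> (nat \<Rightarrow> real) set" where
  "vectors n = {x. \<forall>i. i \<notin> {1..n} \<longrightarrow> x i = 0}"

definition sym_matrices :: "nat \<Rightarrow> (nat \<Rightarrow> nat \<Rightarrow> real) set" where
  "sym_matrices n = {X. (\<forall>i j. X i j = X j i) \<and>
     (\<forall>i j. i \<notin> {1..n} \<or> j \<notin> {1..n} \<longrightarrow> X i j = 0)}"

definition diag_of :: "(nat \<Rightarrow> nat \<Rightarrow> real) \<Rightarrow> nat \<Rightarrow> real" where
  "diag_of X = (\<lambda>i. X i i)"

definition Diag :: "(nat \<Rightarrow> real) \<Rightarrow> nat \<Rightarrow> nat \<Rightarrow> real" where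
  "Diag x = (\<lambda>i j. if i = j then x i else 0)"

text \<open>The dimension of the row space, as in the definition of \<^const>\<open>rank\<close>.\<close>

definition matrix_rank :: "nat \<Rightarrow> (nat \<Rightarrow> nat \<Rightarrow> real) \<Rightarrow> nat" where
  "matrix_rank n X = dim (X ` {1..n})"

definition frobenius :: "nat \<Rightarrow> (nat \<Rightarrow> nat \<Rightarrow> real) \<Rightarrow> (nat \<Rightarrow> nat \<Rightarrow> real) \<Rightarrow> real" where
  "frobenius n X Y = (\<Sum>i=1..n. \<Sum>j=1..n. X i j * Y i j)"

definition symmetric_fun :: "nat \<Rightarrow> ((nat \<Rightarrow> real) \<Rightarrow> real) \<Rightarrow> bool" where
  "symmetric_fun n f \<longleftrightarrow>
     (\<forall>x\<in>vectors n. \<forall>p. p permutes {1..n} \<longrightarrow> f (x \<circ> p) = f x)"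

definition sign_invariant :: "nat \<Rightarrow> ((nat \<Rightarrow> real) \<Rightarrow> real) \<Rightarrow> bool" where
  "sign_invariant n f \<longleftrightarrow> (\<forall>x\<in>vectors n. f x = f (\<lambda>i. \<bar>x i\<bar>))"

definition sum_largest :: "nat \<Rightarrow> nat \<Rightarrow> (nat \<Rightarrow> real) \<Rightarrow> real" where
  "sum_largest n l x = sum_list (take l (rev (sort (map x [1..<Suc n]))))"

definition majorizes :: "nat \<Rightarrow> (nat \<Rightarrow> real) \<Rightarrow> (nat \<Rightarrow> real) \<Rightarrow> bool" where
  "majorizes n x y \<longleftrightarrow>
     (\<forall>l\<in>{1..n}. sum_largest n l x \<ge> sum_largest n l y) \<and>
     (\<Sum>i=1..n. x i) = (\<Sum>i=1..n. y i)"

definition sparse_domain ::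
  "nat \<Rightarrow> nat \<Rightarrow> ((nat \<Rightarrow> real) \<Rightarrow> real) \<Rightarrow> (nat \<Rightarrow> nat \<Rightarrow> real) set" where
  "sparse_domain n k f =
     {X \<in> sym_matrices n. X = Diag (diag_of X) \<and> matrix_rank n X \<le> k \<and> f (diag_of X) \<le> 0}"

definition strengthened_rank :: "nat \<Rightarrow> nat \<Rightarrow> ((nat \<Rightarrow> real) \<Rightarrow> real) \<Rightarrow> nat" where
  "strengthened_rank n k f =
     (LEAST r. 1 \<le> r \<and> r \<le> k \<and>
        convex hull (sparse_domain n k f) = convex hull (sparse_domain n r f))"

text \<open>
  Continuity of \<open>f\<close> refers to the product topology of HOL-Analysis on functions; its restriction
  to \<^term>\<open>vectors n\<close> is the Euclidean topology.  Only the values of \<open>f\<close> on \<^term>\<open>vectors n\<close> matter.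
  The matrix \<open>A 0\<close> is the objective and does not affect feasibility.
\<close>

definition lsop_instance ::
  "nat \<Rightarrow> nat \<Rightarrow> ((nat \<Rightarrow> real) \<Rightarrow> real) \<Rightarrow> nat \<Rightarrow> (nat \<Rightarrow> nat \<Rightarrow> nat \<Rightarrow> real) \<Rightarrow>
   (nat \<Rightarrow> ereal) \<Rightarrow> (nat \<Rightarrow> ereal) \<Rightarrow> bool" where
  "lsop_instance n k f m A bl bu \<longleftrightarrow>
     1 \<le> k \<and> k \<le> n \<and>
     continuous_on (vectors n) f \<and> convex_on (vectors n) f \<and> symmetric_fun n f \<and>
     1 \<le> m \<and> (\<forall>i\<in>{0..m}. A i \<in> sym_matrices n) \<and> (\<forall>i\<in>{1..m}. bl i \<le> bu i)"

definition linear_constraints ::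
  "nat \<Rightarrow> nat \<Rightarrow> (nat \<Rightarrow> nat \<Rightarrow> nat \<Rightarrow> real) \<Rightarrow> (nat \<Rightarrow> ereal) \<Rightarrow> (nat \<Rightarrow> ereal) \<Rightarrow>
   (nat \<Rightarrow> nat \<Rightarrow> real) set" where
  "linear_constraints n m A bl bu =
     {X. \<forall>i\<in>{1..m}. bl i \<le> ereal (frobenius n (A i) X) \<and> ereal (frobenius n (A i) X) \<le> bu i}"

definition lsop_r_feasible ::
  "nat \<Rightarrow> nat \<Rightarrow> ((nat \<Rightarrow> real) \<Rightarrow> real) \<Rightarrow> nat \<Rightarrow> (nat \<Rightarrow> nat \<Rightarrow> nat \<Rightarrow> real) \<Rightarrow>
   (nat \<Rightarrow> ereal) \<Rightarrow> (nat \<Rightarrow> ereal) \<Rightarrow> (nat \<Rightarrow> nat \<Rightarrow> real) set" where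
  "lsop_r_feasible n k f m A bl bu =
     convex hull (sparse_domain n k f) \<inter> linear_constraints n m A bl bu"

text \<open>The argument \<open>kt\<close> stands for the strengthened rank.\<close>

definition Y_hat ::
  "nat \<Rightarrow> nat \<Rightarrow> ((nat \<Rightarrow> real) \<Rightarrow> real) \<Rightarrow> nat \<Rightarrow> (nat \<Rightarrow> nat \<Rightarrow> real) set" where
  "Y_hat n kt f s =
     {X \<in> sym_matrices n. X = Diag (diag_of X) \<and>
        (\<exists>x\<in>vectors n. f x \<le> 0 \<and>
           (\<forall>i j. 1 \<le> i \<and> i \<le> j \<and> j \<le> n \<longrightarrow> x i \<ge> x j) \<and>
           (\<forall>j. s \<le> j \<and> j \<le> s + n - kt - 1 \<longrightarrow> x j = 0) \<and>
           majorizes n x (diag_of X))}"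

definition lsop_r_i_feasible ::
  "nat \<Rightarrow> nat \<Rightarrow> ((nat \<Rightarrow> real) \<Rightarrow> real) \<Rightarrow> nat \<Rightarrow> (nat \<Rightarrow> nat \<Rightarrow> nat \<Rightarrow> real) \<Rightarrow>
   (nat \<Rightarrow> ereal) \<Rightarrow> (nat \<Rightarrow> ereal) \<Rightarrow> nat \<Rightarrow> (nat \<Rightarrow> nat \<Rightarrow> real) set" where
  "lsop_r_i_feasible n k f m A bl bu s =
     Y_hat n (strengthened_rank n k f) f s \<inter> linear_constraints n m A bl bu"

end

theory Submission
  imports Defs
begin

text \<open>
  A polytope cut by \<open>m\<close> independent hyperplanes acquires a new extreme point wherever the
  hyperplanes meet the relative interior of an \<open>m\<close>-dimensional face in exactly one point.  The rank
  bound is therefore attained as soon as the hull has such a face whose relative interior consists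
  of matrices with \<open>k + m\<close> nonzero diagonal entries.

  Sparse vectors in the box \<open>[-1, 1]^n\<close> with \<open>n = k + m\<close> provide one.  The vertices
  \<open>e\<^sub>1 + \<dots> + e\<^bsub>k-1\<^esub> + e\<^sub>j\<close> with \<open>k \<le> j \<le> k + m\<close> span an \<open>m\<close>-dimensional simplex, on which the two
  valid inequalities \<open>x\<^sub>i \<le> 1\<close> (for \<open>i < k\<close>) and \<open>x\<^sub>1 + \<dots> + x\<^sub>n \<le> k\<close> are tight.  Its barycentre has
  no zero entry, and fixing the last \<open>m\<close> coordinates to their value \<open>1 / (m + 1)\<close> at the barycentre
  isolates it.

  Extremality uses only those inequalities, collected in \<open>box_bounds\<close>, and membership of the
  barycentre (lemma \<open>face_centre_extreme\<close>).  The hull of the sparse set and the last of the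
  majorization sets both lie within these bounds (\<open>hull_sparse_box_subset\<close>, \<open>Y_hat_box_subset\<close>) and
  contain the barycentre (\<open>face_centre_in_hull\<close>, \<open>face_centre_in_Y_hat\<close>), so a single instance
  serves both relaxations.  The trace bound also shows that the strengthened rank of the box is \<open>k\<close>
  itself (\<open>strengthened_rank_box\<close>).  The construction works for all positive \<open>k\<close> and \<open>m\<close>, as
  recorded in \<open>rank_bound_attained\<close>.
\<close>

section \<open>Ranks of diagonal matrices\<close>

text \<open>
  If \<open>v i\<close> were in the span of the other vectors, then the functional \<open>\<phi> i\<close>, which kills all of
  these, would kill \<open>v i\<close> as well.
\<close>

lemma independent_family_of_biorthogonal:
  fixes v :: "'i \<Rightarrow> 'a::real_vector" and \<phi> :: "'i \<Rightarrow> 'a \<Rightarrow> real"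
  assumes lin: "\<And>i. i \<in> I \<Longrightarrow> linear (\<phi> i)"
    and diag: "\<And>i. i \<in> I \<Longrightarrow> \<phi> i (v i) \<noteq> 0"
    and off: "\<And>i j. i \<in> I \<Longrightarrow> j \<in> I \<Longrightarrow> i \<noteq> j \<Longrightarrow> \<phi> i (v j) = 0"
  shows "independent (v ` I)" and "inj_on v I"
proof -
  show "inj_on v I"
    by (metis inj_onI diag off)
  show "independent (v ` I)"
    unfolding dependent_def
  proof (clarify)
    fix i assume i: "i \<in> I" and sp: "v i \<in> span (v ` I - {v i})"
    have "\<phi> i (v i) = 0"
      by (rule linear_eq_0_on_span[OF lin[OF i] _ sp]) (use off i in auto)
    with diag[OF i] show False by simp
  qed
qed

lemma linear_coordinate: "linear (\<lambda>x::nat \<Rightarrow> real. x i)"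
  by (rule linearI) auto

lemma linear_diagonal_entry: "linear (\<lambda>X::nat \<Rightarrow> nat \<Rightarrow> real. X i i)"
  by (rule linearI) auto

text \<open>
  The nonzero rows are multiples of distinct unit vectors, so they form a basis of the row space.
\<close>

lemma matrix_rank_Diag: "matrix_rank n (Diag x) = card {i \<in> {1..n}. x i \<noteq> 0}"
proof -
  let ?S = "{i \<in> {1..n}. x i \<noteq> 0}"
  have ind: "independent (Diag x ` ?S)" and inj: "inj_on (Diag x) ?S"
    by (rule independent_family_of_biorthogonal[of ?S "\<lambda>i y. y i"];
        auto simp: Diag_def linear_coordinate)+
  have "Diag x i \<in> span (Diag x ` ?S)" if "i \<in> {1..n}" for i
  proof (cases "x i = 0")
    case True
    then have "Diag x i = 0" by (auto simp: Diag_def fun_eq_iff)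
    then show ?thesis by (simp add: span_zero)
  next
    case False
    with that show ?thesis by (intro span_base) auto
  qed
  then have "dim (Diag x ` {1..n}) = card ?S"
    by (intro dim_unique[OF _ _ ind card_image[OF inj]]) auto
  then show ?thesis by (simp add: matrix_rank_def)
qed

lemma diag_of_Diag [simp]: "diag_of (Diag x) = x"
  by (simp add: diag_of_def Diag_def)

lemma Diag_in_sym_matrices: "x \<in> vectors n \<Longrightarrow> Diag x \<in> sym_matrices n"
  by (auto simp: Diag_def sym_matrices_def vectors_def)

lemma diag_of_in_vectors: "X \<in> sym_matrices n \<Longrightarrow> diag_of X \<in> vectors n"
  by (auto simp: diag_of_def sym_matrices_def vectors_def)

section \<open>Sums of largest entries\<close>

lemma sum_largest_antitone:
  assumes anti: "\<And>i j. 1 \<le> i \<Longrightarrow> i \<le> j \<Longrightarrow> j \<le> n \<Longrightarrow> x j \<le> x i" and "l \<le> n"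
  shows "sum_largest n l x = (\<Sum>i=1..l. x i)"
proof -
  have "sorted (rev (map x [1..<Suc n]))"
    by (auto simp: sorted_iff_nth_mono rev_nth simp del: upt_Suc intro!: anti)
  then have "sort (map x [1..<Suc n]) = rev (map x [1..<Suc n])"
    by (intro properties_for_sort) (auto simp del: upt_Suc)
  then have "sum_largest n l x = sum_list (map x (take l [1..<Suc n]))"
    unfolding sum_largest_def by (metis rev_rev_ident take_map)
  also have "take l [1..<Suc n] = [1..<Suc l]"
    using \<open>l \<le> n\<close> by (simp add: take_upt del: upt_Suc)
  finally show ?thesis
    by (simp add: interv_sum_list_conv_sum_set_nat atLeastLessThanSuc_atLeastAtMost del: upt_Suc)
qed

text \<open>
  With \<open>sum_largest_antitone\<close>, this turns majorization by a nonincreasing \<open>x\<close> into the entrywise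
  bound by \<open>x 1\<close>.
\<close>

lemma entry_le_sum_largest_1:
  assumes "i \<in> {1..n}"
  shows "x i \<le> sum_largest n 1 x"
proof -
  let ?L = "sort (map x [1..<Suc n])"
  have i: "x i \<in> set ?L" using assms by (auto simp del: upt_Suc)
  then have ne: "?L \<noteq> []" by (metis empty_iff list.set(1))
  then have "take 1 (rev ?L) = [last ?L]"
    by (metis hd_rev One_nat_def rev_is_Nil_conv take0 take_Suc)
  moreover have "x i \<le> last ?L"
  proof -
    obtain p where p: "p < length ?L" "x i = ?L ! p" using i by (metis in_set_conv_nth)
    then show ?thesis
      unfolding last_conv_nth[OF ne] p(2) by (intro sorted_nth_mono) (simp_all del: upt_Suc)
  qed
  ultimately show ?thesis by (simp add: sum_largest_def del: upt_Suc)
qed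

section \<open>The box and its sparse part\<close>

text \<open>
  Of the convex functions whose sublevel set at \<open>0\<close> is the box \<open>[-1, 1]^n\<close>, this one is a sum over the
  coordinates, so that continuity, convexity and both invariances can be read off termwise.
\<close>

definition box_excess :: "nat \<Rightarrow> (nat \<Rightarrow> real) \<Rightarrow> real" where
  "box_excess n x = (\<Sum>i=1..n. max 0 (\<bar>x i\<bar> - 1))"

lemma box_excess_nonpos_iff: "box_excess n x \<le> 0 \<longleftrightarrow> (\<forall>i\<in>{1..n}. \<bar>x i\<bar> \<le> 1)"
proof -
  have "box_excess n x \<le> 0 \<longleftrightarrow> box_excess n x = 0"
    unfolding box_excess_def by (metis (no_types, lifting) max.cobounded1 order_antisym_conv sum_nonneg)
  also have "\<dots> \<longleftrightarrow> (\<forall>i\<in>{1..n}. max 0 (\<bar>x i\<bar> - 1) = 0)"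
    unfolding box_excess_def by (rule sum_nonneg_eq_0_iff) auto
  also have "\<dots> \<longleftrightarrow> (\<forall>i\<in>{1..n}. \<bar>x i\<bar> \<le> 1)"
    by (intro ball_cong) (auto simp: max_def)
  finally show ?thesis .
qed

lemma continuous_on_box_excess: "continuous_on S (box_excess n)"
proof -
  have "continuous_on S (\<lambda>x::nat \<Rightarrow> real. x i)" for i
    by (rule continuous_on_product_then_coordinatewise[OF continuous_on_id])
  then show ?thesis
    unfolding box_excess_def[abs_def] by (intro continuous_intros)
qed

lemma convex_on_box_excess: "convex_on (vectors n) (box_excess n)"
proof (rule convex_onI)
  show "convex (vectors n)"
    by (auto simp: convex_def vectors_def)
next
  fix t :: real and x y :: "nat \<Rightarrow> real"
  assume t: "0 < t" "t < 1"
  have "max 0 (\<bar>(1 - t) * a + t * b\<bar> - 1) \<le> (1 - t) * max 0 (\<bar>a\<bar> - 1) + t * max 0 (\<bar>b\<bar> - 1)"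
    for a b :: real
  proof -
    have "\<bar>(1 - t) * a + t * b\<bar> \<le> (1 - t) * \<bar>a\<bar> + t * \<bar>b\<bar>"
      using t by (intro order_trans[OF abs_triangle_ineq]) (simp add: abs_mult)
    moreover have "(1 - t) * (\<bar>a\<bar> - 1) \<le> (1 - t) * max 0 (\<bar>a\<bar> - 1)"
      "t * (\<bar>b\<bar> - 1) \<le> t * max 0 (\<bar>b\<bar> - 1)"
      using t by (auto intro!: mult_left_mono)
    moreover have "0 \<le> (1 - t) * max 0 (\<bar>a\<bar> - 1)" "0 \<le> t * max 0 (\<bar>b\<bar> - 1)"
      using t by auto
    moreover have "(1 - t) * \<bar>a\<bar> + t * \<bar>b\<bar> - 1 = (1 - t) * (\<bar>a\<bar> - 1) + t * (\<bar>b\<bar> - 1)"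
      by (simp add: algebra_simps)
    ultimately have "\<bar>(1 - t) * a + t * b\<bar> - 1
        \<le> (1 - t) * max 0 (\<bar>a\<bar> - 1) + t * max 0 (\<bar>b\<bar> - 1)"
      and "0 \<le> (1 - t) * max 0 (\<bar>a\<bar> - 1) + t * max 0 (\<bar>b\<bar> - 1)"
      by linarith+
    then show ?thesis by (rule max.boundedI[rotated])
  qed
  then show "box_excess n ((1 - t) *\<^sub>R x + t *\<^sub>R y)
      \<le> (1 - t) * box_excess n x + t * box_excess n y"
    unfolding box_excess_def by (auto simp: sum_distrib_left simp flip: sum.distrib intro!: sum_mono)
qed

lemma symmetric_fun_box_excess: "symmetric_fun n (box_excess n)"
  unfolding symmetric_fun_def
proof (intro ballI allI impI)
  fix x p assume "p permutes {1..n}"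
  then show "box_excess n (x \<circ> p) = box_excess n x"
    unfolding box_excess_def comp_def
    by (rule sum.permute[unfolded comp_def, symmetric])
qed

lemma sign_invariant_box_excess: "sign_invariant n (box_excess n)"
  by (simp add: sign_invariant_def box_excess_def)

abbreviation sparse_box :: "nat \<Rightarrow> nat \<Rightarrow> (nat \<Rightarrow> nat \<Rightarrow> real) set" where
  "sparse_box n k \<equiv> sparse_domain n k (box_excess n)"

lemma Diag_in_sparse_box_iff:
  assumes "x \<in> vectors n"
  shows "Diag x \<in> sparse_box n k \<longleftrightarrow>
    card {i \<in> {1..n}. x i \<noteq> 0} \<le> k \<and> (\<forall>i\<in>{1..n}. \<bar>x i\<bar> \<le> 1)"
  by (simp add: sparse_domain_def Diag_in_sym_matrices[OF assms] matrix_rank_Diag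
      box_excess_nonpos_iff)

lemma Diag_indicator_in_sparse_box:
  assumes "S \<subseteq> {1..n}" and "card S \<le> k"
  shows "Diag (indicator S) \<in> sparse_box n k"
proof -
  have "{i \<in> {1..n}. (indicator S i :: real) \<noteq> 0} = S"
    using assms by (auto simp: indicator_def)
  moreover have "indicator S \<in> vectors n"
    using assms by (auto simp: vectors_def indicator_def)
  ultimately show ?thesis
    using assms by (simp add: Diag_in_sparse_box_iff indicator_def)
qed

text \<open>
  A common outer approximation of the feasible sets of the two relaxations.  It keeps just the
  inequalities that are tight at the extreme point constructed below.
\<close>

definition box_bounds :: "nat \<Rightarrow> nat \<Rightarrow> (nat \<Rightarrow> nat \<Rightarrow> real) set" where
  "box_bounds n k = {Y. Y \<in> sym_matrices n \<and> Y = Diag (diag_of Y) \<and>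
     (\<forall>i\<in>{1..n}. Y i i \<le> 1) \<and> (\<Sum>i=1..n. Y i i) \<le> real k}"

lemma convex_box_bounds: "convex (box_bounds n k)"
proof (rule convexI)
  fix X Y and u v :: real
  assume X: "X \<in> box_bounds n k" and Y: "Y \<in> box_bounds n k"
    and uv: "0 \<le> u" "0 \<le> v" "u + v = 1"
  let ?Z = "u *\<^sub>R X + v *\<^sub>R Y"
  have "?Z \<in> sym_matrices n"
    using X Y by (auto simp: box_bounds_def sym_matrices_def)
  moreover have "?Z = Diag (diag_of ?Z)"
  proof -
    have "X i j = 0" "Y i j = 0" if "i \<noteq> j" for i j
      using X Y that unfolding box_bounds_def Diag_def by (simp_all, metis+)
    then show ?thesis by (auto simp: Diag_def diag_of_def fun_eq_iff)
  qed
  moreover have "?Z i i \<le> 1" if "i \<in> {1..n}" for i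
    using X Y uv that by (auto simp: box_bounds_def intro!: convex_bound_le)
  moreover have "(\<Sum>i=1..n. ?Z i i) \<le> real k"
  proof -
    have "(\<Sum>i=1..n. ?Z i i) = u * (\<Sum>i=1..n. X i i) + v * (\<Sum>i=1..n. Y i i)"
      by (simp add: sum.distrib sum_distrib_left)
    also have "\<dots> \<le> real k"
      using X Y uv by (intro convex_bound_le) (auto simp: box_bounds_def)
    finally show ?thesis .
  qed
  ultimately show "?Z \<in> box_bounds n k"
    by (simp add: box_bounds_def)
qed

text \<open>
  At most \<open>k\<close> diagonal entries are nonzero and each of them is at most \<open>1\<close>, hence the trace bound.
\<close>

lemma sparse_box_subset_box_bounds: "sparse_box n k \<subseteq> box_bounds n k"
proof
  fix Y assume Y: "Y \<in> sparse_box n k"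
  define y where "y = diag_of Y"
  have YD: "Y = Diag y" and sym: "Y \<in> sym_matrices n"
    using Y by (auto simp: sparse_domain_def y_def)
  have "y \<in> vectors n" using sym by (simp add: y_def diag_of_in_vectors)
  with Y YD have card: "card {i \<in> {1..n}. y i \<noteq> 0} \<le> k" and le: "\<forall>i\<in>{1..n}. \<bar>y i\<bar> \<le> 1"
    by (simp_all add: Diag_in_sparse_box_iff)
  have "(\<Sum>i=1..n. y i) = (\<Sum>i\<in>{i \<in> {1..n}. y i \<noteq> 0}. y i)"
    by (rule sum.mono_neutral_right) auto
  also have "\<dots> \<le> (\<Sum>i\<in>{i \<in> {1..n}. y i \<noteq> 0}. 1)"
    by (rule sum_mono) (use le in fastforce)
  also have "\<dots> \<le> real k" using card by simp
  finally show "Y \<in> box_bounds n k"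
    using sym le YD by (force simp: box_bounds_def Diag_def diag_of_def)
qed

lemma hull_sparse_box_subset: "convex hull (sparse_box n k) \<subseteq> box_bounds n k"
  by (intro hull_minimal sparse_box_subset_box_bounds convex_box_bounds)

lemma sum_indicator_initial_segment:
  "(\<Sum>i=1..l. indicator {1..k} i :: real) = real (min l k)" for k l :: nat
proof -
  have "(\<Sum>i=1..l. indicator {1..k} i :: real) = (\<Sum>i\<in>{1..l} \<inter> {1..k}. 1)"
    by (rule sum.mono_neutral_cong_right) (auto simp: indicator_def)
  then show ?thesis by simp
qed

text \<open>
  The trace separates the hulls: it is at most \<open>r\<close> on the hull for sparsity \<open>r\<close>, but equals \<open>k\<close> at
  the matrix with \<open>k\<close> ones.
\<close>

lemma strengthened_rank_box:
  assumes "1 \<le> k" "k \<le> n"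
  shows "strengthened_rank n k (box_excess n) = k"
  unfolding strengthened_rank_def
proof (rule Least_equality)
  show "1 \<le> k \<and> k \<le> k \<and> convex hull (sparse_box n k) = convex hull (sparse_box n k)"
    using assms by simp
next
  fix r assume r: "1 \<le> r \<and> r \<le> k \<and>
    convex hull (sparse_box n k) = convex hull (sparse_box n r)"
  have "Diag (indicator {1..k}) \<in> sparse_box n k"
    using assms by (intro Diag_indicator_in_sparse_box) auto
  then have "Diag (indicator {1..k}) \<in> convex hull (sparse_box n r)"
    using r by (metis hull_inc)
  then have "(\<Sum>i=1..n. indicator {1..k} i :: real) \<le> real r"
    using hull_sparse_box_subset by (force simp: box_bounds_def Diag_def)
  then show "k \<le> r"
    using assms unfolding sum_indicator_initial_segment by simp
qed

text \<open>
  For \<open>s = k + 1\<close> the vanishing block of the majorizing vector consists of its last \<open>n - k\<close> entries.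
  Majorization transfers to \<open>Y\<close> the bound \<open>1\<close> on its largest entry and the bound \<open>k\<close> on its sum.
\<close>

lemma Y_hat_box_subset:
  assumes "1 \<le> k" "k \<le> n"
  shows "Y_hat n k (box_excess n) (k + 1) \<subseteq> box_bounds n k"
proof
  fix Y assume "Y \<in> Y_hat n k (box_excess n) (k + 1)"
  then obtain x where Y: "Y \<in> sym_matrices n" "Y = Diag (diag_of Y)"
    and le: "\<forall>i\<in>{1..n}. \<bar>x i\<bar> \<le> 1"
    and anti: "\<And>i j. 1 \<le> i \<Longrightarrow> i \<le> j \<Longrightarrow> j \<le> n \<Longrightarrow> x j \<le> x i"
    and zero: "\<And>j. k + 1 \<le> j \<Longrightarrow> j \<le> n \<Longrightarrow> x j = 0"
    and maj: "majorizes n x (diag_of Y)"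
    using assms by (auto simp: Y_hat_def box_excess_nonpos_iff)
  have "Y i i \<le> 1" if i: "i \<in> {1..n}" for i
  proof -
    have "Y i i \<le> sum_largest n 1 (diag_of Y)"
      using entry_le_sum_largest_1[OF i, of "diag_of Y"] by (simp add: diag_of_def)
    also have "\<dots> \<le> sum_largest n 1 x"
      using maj assms by (simp add: majorizes_def)
    also have "\<dots> = x 1"
      using assms by (subst sum_largest_antitone) (auto intro: anti)
    also have "\<dots> \<le> 1"
      using le assms by (auto dest!: bspec[of _ _ 1])
    finally show ?thesis .
  qed
  moreover have "(\<Sum>i=1..n. Y i i) \<le> real k"
  proof -
    have "(\<Sum>i=1..n. Y i i) = (\<Sum>i=1..n. x i)"
      using maj by (simp add: majorizes_def diag_of_def)
    also have "\<dots> = (\<Sum>i=1..k. x i)"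
      using assms zero by (intro sum.mono_neutral_right) auto
    also have "\<dots> \<le> (\<Sum>i=1..k. 1)"
      using le assms by (intro sum_mono) (simp add: abs_le_iff)
    finally show ?thesis by simp
  qed
  ultimately show "Y \<in> box_bounds n k"
    using Y by (simp add: box_bounds_def)
qed

section \<open>The extreme point\<close>

text \<open>
  The barycentre of the vertices \<open>e\<^sub>1 + \<dots> + e\<^bsub>k-1\<^esub> + e\<^sub>j\<close>, where \<open>k \<le> j \<le> k + m\<close>.
\<close>

definition face_centre :: "nat \<Rightarrow> nat \<Rightarrow> nat \<Rightarrow> real" where
  "face_centre k m i =
     (if i \<in> {1..<k} then 1 else if i \<in> {k..k + m} then 1 / real (m + 1) else 0)"

lemma face_centre_in_vectors: "1 \<le> k \<Longrightarrow> face_centre k m \<in> vectors (k + m)"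
  by (auto simp: vectors_def face_centre_def)

lemma face_centre_le_1: "face_centre k m i \<le> 1"
  by (simp add: face_centre_def field_simps)

lemma sum_face_centre:
  assumes "1 \<le> k"
  shows "(\<Sum>i=1..k + m. face_centre k m i) = real k"
proof -
  have "{1..k + m} = {1..<k} \<union> {k..k + m}" using assms by auto
  then have "(\<Sum>i=1..k + m. face_centre k m i) =
      (\<Sum>i\<in>{1..<k}. face_centre k m i) + (\<Sum>i\<in>{k..k + m}. face_centre k m i)"
    by (simp add: sum.union_disjoint ivl_disj_int)
  also have "(\<Sum>i\<in>{1..<k}. face_centre k m i) = (\<Sum>i\<in>{1..<k}. 1)"
    by (rule sum.cong) (auto simp: face_centre_def)
  also have "(\<Sum>i\<in>{k..k + m}. face_centre k m i) = (\<Sum>i\<in>{k..k + m}. 1 / real (m + 1))"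
    by (rule sum.cong) (auto simp: face_centre_def)
  finally show ?thesis
    using assms by (simp add: of_nat_diff)
qed

lemma matrix_rank_face_centre:
  assumes "1 \<le> k"
  shows "matrix_rank (k + m) (Diag (face_centre k m)) = k + m"
proof -
  have "{i \<in> {1..k + m}. face_centre k m i \<noteq> 0} = {1..k + m}"
    by (auto simp: face_centre_def)
  then show ?thesis by (simp add: matrix_rank_Diag)
qed

lemma face_centre_in_hull:
  assumes "1 \<le> k"
  shows "Diag (face_centre k m) \<in> convex hull (sparse_box (k + m) k)"
proof -
  \<comment> \<open>The vertices of the simplex; each is a sparse 0-1 matrix with \<open>k\<close> ones.\<close>
  define V where "V j = Diag (indicator (insert j {1..<k}))" for j :: nat
  have "V j \<in> sparse_box (k + m) k" if "j \<in> {k..k + m}" for j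
    unfolding V_def using assms that by (intro Diag_indicator_in_sparse_box) auto
  then have "(\<Sum>j\<in>{k..k + m}. (1 / real (m + 1)) *\<^sub>R V j) \<in> convex hull (sparse_box (k + m) k)"
    by (intro convex_sum convex_convex_hull) (auto intro: hull_inc)
  also have "(\<Sum>j\<in>{k..k + m}. (1 / real (m + 1)) *\<^sub>R V j) = Diag (face_centre k m)"
  proof (intro ext)
    fix a b
    have app: "(\<Sum>j\<in>J. g j) p q = (\<Sum>j\<in>J. g j p q)"
      for g :: "nat \<Rightarrow> nat \<Rightarrow> nat \<Rightarrow> real" and J p q
      by (induction J rule: infinite_finite_induct) auto
    have "(\<Sum>j\<in>{k..k + m}. (1 / real (m + 1)) * indicator (insert j {1..<k}) a) = face_centre k m a"
    proof (cases "a \<in> {1..<k}")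
      case True
      then show ?thesis by (simp add: face_centre_def indicator_def)
    next
      case False
      then have "(\<Sum>j\<in>{k..k + m}. (1 / real (m + 1)) * indicator (insert j {1..<k}) a) =
          (\<Sum>j\<in>{k..k + m}. if j = a then 1 / real (m + 1) else 0)"
        by (intro sum.cong) (auto simp: indicator_def)
      also have "\<dots> = face_centre k m a"
        using False by (simp add: face_centre_def)
      finally show ?thesis .
    qed
    then show "(\<Sum>j\<in>{k..k + m}. (1 / real (m + 1)) *\<^sub>R V j) a b = Diag (face_centre k m) a b"
      by (cases "a = b") (simp_all add: app V_def Diag_def)
  qed
  finally show ?thesis .
qed

text \<open>
  The vector of \<open>k\<close> ones followed by zeros majorizes the barycentre: the sum of its \<open>l\<close> largest entries
  is \<open>min l k\<close>, whereas any \<open>l\<close> entries of the barycentre sum to at most \<open>l\<close>, since none exceeds \<open>1\<close>,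
  and to at most \<open>k\<close>, the total of its nonnegative entries.
\<close>

lemma face_centre_in_Y_hat:
  assumes "1 \<le> k"
  shows "Diag (face_centre k m) \<in> Y_hat (k + m) k (box_excess (k + m)) (k + 1)"
proof -
  let ?n = "k + m"
  let ?x = "indicator {1..k} :: nat \<Rightarrow> real"
  have x: "?x \<in> vectors ?n" "box_excess ?n ?x \<le> 0"
    by (auto simp: vectors_def box_excess_nonpos_iff indicator_def)
  have anti: "?x j \<le> ?x i" if "1 \<le> i" "i \<le> j" for i j
    using that by (auto simp: indicator_def)
  have anti': "face_centre k m j \<le> face_centre k m i" if "1 \<le> i" "i \<le> j" for i j
    using that by (auto simp: face_centre_def field_simps)
  have "sum_largest ?n l (face_centre k m) \<le> sum_largest ?n l ?x" if l: "l \<in> {1..?n}" for l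
  proof -
    have "(\<Sum>i=1..l. face_centre k m i) \<le> (\<Sum>i=1..l. 1)"
      by (rule sum_mono) (rule face_centre_le_1)
    moreover have "(\<Sum>i=1..l. face_centre k m i) \<le> (\<Sum>i=1..?n. face_centre k m i)"
      using l by (intro sum_mono2) (auto simp: face_centre_def)
    ultimately have "(\<Sum>i=1..l. face_centre k m i) \<le> (\<Sum>i=1..l. ?x i)"
      by (simp add: sum_face_centre[OF assms] sum_indicator_initial_segment del: One_nat_def)
    moreover have "sum_largest ?n l ?x = (\<Sum>i=1..l. ?x i)"
      using l by (intro sum_largest_antitone anti) auto
    moreover have "sum_largest ?n l (face_centre k m) = (\<Sum>i=1..l. face_centre k m i)"
      using l by (intro sum_largest_antitone anti') auto
    ultimately show ?thesis by linarith
  qed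
  then have maj: "majorizes ?n ?x (face_centre k m)"
    by (simp add: majorizes_def sum_face_centre[OF assms] sum_indicator_initial_segment del: One_nat_def)
  show ?thesis
    unfolding Y_hat_def
  proof (intro CollectI conjI bexI[of _ ?x])
    show "Diag (face_centre k m) \<in> sym_matrices ?n"
      by (rule Diag_in_sym_matrices[OF face_centre_in_vectors[OF assms]])
  qed (use x maj anti in \<open>auto simp: indicator_def\<close>)
qed

text \<open>
  The matrix unit with its one at position \<open>(k + i, k + i)\<close>, so that \<open>pinning k 1\<close>, ..., \<open>pinning k m\<close>
  read off the last \<open>m\<close> diagonal entries.
\<close>

definition pinning :: "nat \<Rightarrow> nat \<Rightarrow> nat \<Rightarrow> nat \<Rightarrow> real" where
  "pinning k i = Diag (indicator {k + i})"

lemma frobenius_pinning: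
  assumes "k + i \<in> {1..n}"
  shows "frobenius n (pinning k i) X = X (k + i) (k + i)"
proof -
  have "frobenius n (pinning k i) X =
      (\<Sum>a=1..n. \<Sum>b=1..n. if b = a then (if a = k + i then X a a else 0) else 0)"
    unfolding frobenius_def pinning_def
    by (intro sum.cong) (auto simp: Diag_def indicator_def)
  also have "\<dots> = (\<Sum>a=1..n. if a = k + i then X a a else 0)"
    by (intro sum.cong) auto
  also have "\<dots> = X (k + i) (k + i)"
    using assms by simp
  finally show ?thesis .
qed

lemma dim_span_pinning: "dim (span (pinning k ` {1..m})) = m"
proof -
  have "independent (pinning k ` {1..m})" and inj: "inj_on (pinning k) {1..m}"
    by (rule independent_family_of_biorthogonal[of _ "\<lambda>i X. X (k + i) (k + i)"];
        auto simp: pinning_def Diag_def linear_diagonal_entry)+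
  then have "dim (pinning k ` {1..m}) = card (pinning k ` {1..m})"
    by (intro dim_eq_card_independent)
  then show ?thesis by (simp add: dim_span card_image[OF inj] del: One_nat_def)
qed

abbreviation pinned :: "nat \<Rightarrow> nat \<Rightarrow> (nat \<Rightarrow> nat \<Rightarrow> real) set" where
  "pinned k m \<equiv> linear_constraints (k + m) m (pinning k)
     (\<lambda>_. ereal (1 / real (m + 1))) (\<lambda>_. ereal (1 / real (m + 1)))"

lemma pinned_iff: 
  assumes "1 \<le> k"
  shows "X \<in> pinned k m \<longleftrightarrow> (\<forall>i\<in>{1..m}. X (k + i) (k + i) = 1 / real (m + 1))"
  using assms by (auto simp: linear_constraints_def frobenius_pinning intro!: antisym)

lemma lsop_instance_pinned_box:
  assumes "1 \<le> k" "1 \<le> m"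
  shows "lsop_instance (k + m) k (box_excess (k + m)) m (pinning k)
     (\<lambda>_. ereal (1 / real (m + 1))) (\<lambda>_. ereal (1 / real (m + 1)))"
proof -
  have "pinning k i \<in> sym_matrices (k + m)" if "i \<le> m" for i
    unfolding pinning_def using assms that
    by (intro Diag_in_sym_matrices) (auto simp: vectors_def indicator_def)
  then show ?thesis
    using assms by (simp add: lsop_instance_def continuous_on_box_excess convex_on_box_excess
        symmetric_fun_box_excess)
qed


text \<open>
  Whenever a point of a segment attains an upper bound that holds at both ends, the ends attain it
  too.  This applies to the first \<open>k - 1\<close> diagonal entries, which are at most \<open>1\<close>; the last \<open>m\<close> are
  prescribed.  The trace bound then caps entry \<open>k\<close> by its value at the barycentre, and the same
  argument settles that entry.
\<close>

lemma face_centre_extreme: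
  assumes k: "1 \<le> k" and sub: "C \<subseteq> box_bounds (k + m) k" and mem: "Diag (face_centre k m) \<in> C"
  shows "Diag (face_centre k m) extreme_point_of (C \<inter> pinned k m)"
proof -
  let ?c = "face_centre k m"
  have cpin: "Diag ?c \<in> pinned k m"
    unfolding pinned_iff[OF k] by (auto simp: Diag_def face_centre_def)
  have "a = b" if a: "a \<in> C \<inter> pinned k m" and b: "b \<in> C \<inter> pinned k m"
    and t: "0 < t" "t < 1" and eq: "Diag ?c = (1 - t) *\<^sub>R a + t *\<^sub>R b" for a b t
  proof -
    have conv: "(1 - t) * a i i + t * b i i = ?c i" for i
      using fun_cong[OF fun_cong[OF eq, of i], of i] by (simp add: Diag_def)
    \<comment> \<open>The principle that a bound attained inside a segment is attained at its ends.\<close>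
    have tight: "p = r \<and> q = r" if "(1 - t) * p + t * q = r" "p \<le> r" "q \<le> r" for p q r :: real
    proof -
      have "(1 - t) * (r - p) + t * (r - q) = 0"
        using that(1) by (simp add: algebra_simps)
      moreover have "0 \<le> (1 - t) * (r - p)" "0 \<le> t * (r - q)"
        using that t by auto
      ultimately have "(1 - t) * (r - p) = 0" "t * (r - q) = 0" by linarith+
      then show ?thesis using t by auto
    qed
    have ab: "a \<in> box_bounds (k + m) k" "b \<in> box_bounds (k + m) k"
      using a b sub by auto
    have off: "a i i = ?c i \<and> b i i = ?c i" if i: "i \<in> {1..k + m} - {k}" for i
    proof (cases "i < k")
      case True
      then have "?c i = 1" using i by (simp add: face_centre_def)
      then show ?thesis
        using ab i by (intro tight[OF conv]) (auto simp: box_bounds_def)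
    next
      case False
      then have j: "i - k \<in> {1..m}" "k + (i - k) = i" using i by auto
      have "y i i = 1 / real (m + 1)" if "y \<in> pinned k m" for y
        using that j unfolding pinned_iff[OF k] by metis
      moreover have "?c i = 1 / real (m + 1)" using False i by (simp add: face_centre_def)
      ultimately show ?thesis using a b by simp
    qed
    have trace: "(\<Sum>i=1..k + m. g i) = g k + (\<Sum>i\<in>{1..k + m} - {k}. g i)" for g :: "nat \<Rightarrow> real"
      using k by (intro sum.remove) auto
    have "y k k \<le> ?c k" if "y = a \<or> y = b" for y
    proof -
      have "(\<Sum>i\<in>{1..k + m} - {k}. y i i) = (\<Sum>i\<in>{1..k + m} - {k}. ?c i)"
        by (rule sum.cong) (use that off in auto)
      moreover have "(\<Sum>i=1..k + m. y i i) \<le> (\<Sum>i=1..k + m. ?c i)"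
        using that ab by (auto simp: box_bounds_def sum_face_centre[OF k] simp del: One_nat_def)
      ultimately show ?thesis
        unfolding trace by linarith
    qed
    then have "a k k = ?c k \<and> b k k = ?c k"
      by (intro tight[OF conv]) auto
    with off have eqd: "a i i = b i i" if "i \<in> {1..k + m}" for i
      using that by (cases "i = k") auto
    have sym: "a \<in> sym_matrices (k + m)" "b \<in> sym_matrices (k + m)"
      and dia: "a = Diag (diag_of a)" "b = Diag (diag_of b)"
      using ab by (auto simp: box_bounds_def)
    have "diag_of a = diag_of b"
    proof
      fix i
      show "diag_of a i = diag_of b i"
        using eqd[of i] sym by (cases "i \<in> {1..k + m}") (auto simp: sym_matrices_def diag_of_def)
    qed
    with dia show "a = b" by metis
  qed
  then show ?thesis
    using mem cpin by (auto simp: extreme_point_of_def in_segment)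
qed

section \<open>Tightness\<close>

text \<open>
  One point attains the bound for both relaxations, whatever the sparsity \<open>k\<close> and the number \<open>m\<close> of
  independent constraints.
\<close>

lemma rank_bound_attained:
  fixes k m :: nat
  defines "n \<equiv> k + m" and "f \<equiv> box_excess (k + m)" and "b \<equiv> \<lambda>_. ereal (1 / real (m + 1))"
    and "X \<equiv> Diag (face_centre k m)"
  assumes k: "1 \<le> k"
  shows "strengthened_rank n k f = k"
    and "dim (span (pinning k ` {1..m})) = m"
    and "matrix_rank n X = k + m"
    and "X extreme_point_of (lsop_r_feasible n k f m (pinning k) b b)"
    and "X extreme_point_of (lsop_r_i_feasible n k f m (pinning k) b b (k + 1))"
proof -
  show sr: "strengthened_rank n k f = k"
    unfolding n_def f_def using k by (intro strengthened_rank_box) auto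
  show "dim (span (pinning k ` {1..m})) = m"
    by (rule dim_span_pinning)
  show "matrix_rank n X = k + m"
    unfolding n_def X_def by (rule matrix_rank_face_centre[OF k])
  show "X extreme_point_of (lsop_r_feasible n k f m (pinning k) b b)"
    unfolding lsop_r_feasible_def n_def f_def b_def X_def
    by (rule face_centre_extreme[OF k hull_sparse_box_subset face_centre_in_hull[OF k]])
  show "X extreme_point_of (lsop_r_i_feasible n k f m (pinning k) b b (k + 1))"
    unfolding lsop_r_i_feasible_def sr unfolding n_def f_def b_def X_def
    by (rule face_centre_extreme[OF k Y_hat_box_subset[OF k] face_centre_in_Y_hat[OF k]]) simp
qed

theorem theorem12:
  shows
    "(\<exists>n k f m A bl bu X.
        lsop_instance n k f m A bl bu \<and> sign_invariant n f \<and>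
        X extreme_point_of (lsop_r_feasible n k f m A bl bu) \<and>
        matrix_rank n X = strengthened_rank n k f + dim (span (A ` {1..m})))
   \<and> (\<exists>n k f m A bl bu s X.
        lsop_instance n k f m A bl bu \<and>
        s \<in> {1..strengthened_rank n k f + 1} \<and>
        X extreme_point_of (lsop_r_i_feasible n k f m A bl bu s) \<and>
        matrix_rank n X = strengthened_rank n k f + dim (span (A ` {1..m})))"
proof -
  let ?k = "1 :: nat" and ?m = "1 :: nat"
  let ?n = "?k + ?m" and ?b = "\<lambda>_::nat. ereal (1 / real (?m + 1))"
  let ?f = "box_excess ?n" and ?X = "Diag (face_centre ?k ?m)"
  have k: "1 \<le> ?k" by simp
  note facts = rank_bound_attained[OF k, of ?m]
  have inst: "lsop_instance ?n ?k ?f ?m (pinning ?k) ?b ?b"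
    by (rule lsop_instance_pinned_box) simp_all
  have rank: "matrix_rank ?n ?X =
      strengthened_rank ?n ?k ?f + dim (span (pinning ?k ` {1..?m}))"
    by (simp only: facts(1-3))
  have s: "?k + 1 \<in> {1..strengthened_rank ?n ?k ?f + 1}"
    unfolding facts(1) by simp
  show ?thesis
  proof (rule conjI)
    show "\<exists>n k f m A bl bu X.
        lsop_instance n k f m A bl bu \<and> sign_invariant n f \<and>
        X extreme_point_of (lsop_r_feasible n k f m A bl bu) \<and>
        matrix_rank n X = strengthened_rank n k f + dim (span (A ` {1..m}))"
      by (rule exI[of _ ?n], rule exI[of _ ?k], rule exI[of _ ?f], rule exI[of _ ?m],
          rule exI[of _ "pinning ?k"], rule exI[of _ ?b], rule exI[of _ ?b], rule exI[of _ ?X])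
        (rule conjI[OF inst conjI[OF sign_invariant_box_excess conjI[OF facts(4) rank]]])
    show "\<exists>n k f m A bl bu s X.
        lsop_instance n k f m A bl bu \<and>
        s \<in> {1..strengthened_rank n k f + 1} \<and>
        X extreme_point_of (lsop_r_i_feasible n k f m A bl bu s) \<and>
        matrix_rank n X = strengthened_rank n k f + dim (span (A ` {1..m}))"
      by (rule exI[of _ ?n], rule exI[of _ ?k], rule exI[of _ ?f], rule exI[of _ ?m],
          rule exI[of _ "pinning ?k"], rule exI[of _ ?b], rule exI[of _ ?b],
          rule exI[of _ "?k + 1"], rule exI[of _ ?X])
        (rule conjI[OF inst conjI[OF s conjI[OF facts(5) rank]]])
  qed
qed

end
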